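(* Let $\mathcal X=[0,1]^D$, $\lambda\in(0,1/2)$, $\alpha_0>0$, $0<\beta\le1$ and $L\ge3$. Let $\mathcal P(L,\beta,\alpha_0)$ be the class of joint distributions $P_{XY}$ on $\mathcal X\times\{0,1\}$ which satisfy the margin assumption (at the thresholds $\lambda$ and $1-\lambda$) with exponent $\alpha_0$ and whose regression function $\eta$ is $(L,\beta)$ Hölder continuous. For any active learning algorithm $\mathcal A$, let $\hat g_n$ be the abstaining classifier learned by $\mathcal A$ with $n$ label queries. Then there is a constant $C>0$, not depending on $n$, such that $$\inf_{\mathcal A}\ \sup_{P_{XY}\in\mathcal P(L,\beta,\alpha_0)}\ \mathbb E\left[R_\lambda(\hat g_n)-R_\lambda(g^*_\lambda)\right]\ \ge\ C\,n^{-\beta(1+\alpha_0)/(2\beta+D)}.$$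
   Context: For a joint distribution $P_{XY}$ on $\mathcal X\times\{0,1\}$, $P_X$ is the marginal of $X$ and $\eta(x)=P(Y=1\mid X=x)$. An abstaining classifier is a map $g:\mathcal X\to\{0,1,\Delta\}$ ($\Delta$ = abstain). With abstention cost $\lambda$, the risk is $R_\lambda(g)=P_{XY}(g(X)\ne Y,\ g(X)\ne\Delta)+\lambda P_X(g(X)=\Delta)$, and the Bayes optimal classifier $g^*_\lambda$ takes value $1$, $0$ or $\Delta$ at $x$ according to whether $1-\eta(x)$, $\eta(x)$ or $\lambda$ is the smallest. Margin assumption with exponent $\alpha_0$: there is $C_0>0$ with $P_X(|\eta(X)-\gamma|\le t)\le C_0t^{\alpha_0}$ for all $0<t\le1$ and $\gamma\in\{\lambda,1-\lambda\}$. $(L,\beta)$ Hölder continuity: $|\eta(x_1)-\eta(x_2)|\le L\|x_1-x_2\|_2^\beta$ for all $x_1,x_2\in\mathcal X$. An active learning algorithm (membership query model) with $n$ label queries sequentially chooses query points $X_1,\dots,X_n\in\mathcal X$, where $X_t$ may depend on $(X_s,Y_s)_{s<t}$ (and internal randomness), observes $Y_t\sim\mathrm{Bernoulli}(\eta(X_t))$ (conditionally independent of the past given $X_t$), and outputs a classifier $\hat g_n$ depending on the collected data. The expectation is over the data and the algorithm's randomness. *)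

theory Defs
  imports "HOL-Probability.Probability"
begin

text \<open>Labels are booleans (\<open>True\<close> for \<open>1\<close>). An abstaining classifier takes values in
  \<open>bool option\<close>, where \<open>None\<close> is the decision to abstain.\<close>

type_synonym 'n point = "real ^ 'n"
type_synonym 'n classifier = "'n point \<Rightarrow> bool option"

definition cube_space :: "('n::finite) point measure" where
  "cube_space = restrict_space borel (cbox 0 1)"

definition example_space :: "(('n::finite) point \<times> bool) measure" where
  "example_space = cube_space \<Otimes>\<^sub>M count_space UNIV"

definition marginal :: "(('n::finite) point \<times> bool) measure \<Rightarrow> 'n point measure" where
  "marginal P = distr P cube_space fst"

text \<open>The function \<open>\<eta>\<close> is a version of the conditional probability \<open>P(Y = 1 | X = x)\<close>. It is
  determined by \<open>P\<close> only up to null sets of the marginal, whereas label queries and Hoelder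
  continuity refer to its values on the whole cube. A problem instance is therefore a pair
  \<open>(P, \<eta>)\<close>.\<close>

definition regression_function ::
    "(('n::finite) point \<times> bool) measure \<Rightarrow> ('n point \<Rightarrow> real) \<Rightarrow> bool" where
  "regression_function P \<eta> \<longleftrightarrow>
     \<eta> \<in> borel_measurable cube_space \<and>
     (\<forall>x\<in>cbox 0 1. 0 \<le> \<eta> x \<and> \<eta> x \<le> 1) \<and>
     (\<forall>A\<in>sets cube_space.
        measure P (A \<times> {True}) = set_lebesgue_integral (marginal P) A \<eta>)"

definition risk :: "real \<Rightarrow> (('n::finite) point \<times> bool) measure \<Rightarrow> 'n classifier \<Rightarrow> real" where
  "risk lam P g =
     measure P {z \<in> space P. g (fst z) \<noteq> Some (snd z) \<and> g (fst z) \<noteq> None}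
     + lam * measure (marginal P) {x \<in> space (marginal P). g x = None}"

text \<open>The way ties are broken does not affect the risk.\<close>

definition bayes_classifier :: "real \<Rightarrow> (('n::finite) point \<Rightarrow> real) \<Rightarrow> 'n classifier" where
  "bayes_classifier lam \<eta> x =
     (if 1 - \<eta> x \<le> \<eta> x \<and> 1 - \<eta> x \<le> lam then Some True
      else if \<eta> x \<le> 1 - \<eta> x \<and> \<eta> x \<le> lam then Some False
      else None)"

definition margin_with ::
    "real \<Rightarrow> real \<Rightarrow> real \<Rightarrow> (('n::finite) point \<times> bool) measure \<Rightarrow> ('n point \<Rightarrow> real) \<Rightarrow> bool" where
  "margin_with C0 \<alpha>0 lam P \<eta> \<longleftrightarrow>
     (\<forall>t. 0 < t \<and> t \<le> 1 \<longrightarrow> (\<forall>\<gamma>\<in>{lam, 1 - lam}.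
        measure (marginal P) {x \<in> space (marginal P). \<bar>\<eta> x - \<gamma>\<bar> \<le> t} \<le> C0 * t powr \<alpha>0))"

definition hoelder :: "real \<Rightarrow> real \<Rightarrow> (('n::finite) point \<Rightarrow> real) \<Rightarrow> bool" where
  "hoelder L \<beta> \<eta> \<longleftrightarrow>
     (\<forall>x\<in>cbox 0 1. \<forall>y\<in>cbox 0 1. \<bar>\<eta> x - \<eta> y\<bar> \<le> L * norm (x - y) powr \<beta>)"

text \<open>The class of instances whose margin constant is the given \<open>C0\<close>, and the class of instances
  that have some margin constant.\<close>

definition instances_with ::
    "real \<Rightarrow> real \<Rightarrow> real \<Rightarrow> real \<Rightarrow> real
      \<Rightarrow> ((('n::finite) point \<times> bool) measure \<times> ('n point \<Rightarrow> real)) set" where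
  "instances_with C0 L \<beta> \<alpha>0 lam =
     {(P, \<eta>). prob_space P \<and> sets P = sets example_space \<and> regression_function P \<eta> \<and>
        margin_with C0 \<alpha>0 lam P \<eta> \<and> hoelder L \<beta> \<eta>}"

definition instances ::
    "real \<Rightarrow> real \<Rightarrow> real \<Rightarrow> real
      \<Rightarrow> ((('n::finite) point \<times> bool) measure \<times> ('n point \<Rightarrow> real)) set" where
  "instances L \<beta> \<alpha>0 lam = (\<Union>C0\<in>{0<..}. instances_with C0 L \<beta> \<alpha>0 lam)"

text \<open>A learner draws its internal randomness \<open>u\<close> once, from an arbitrary probability space on the
  reals. Given the first \<open>t\<close> examples \<open>h 0, \<dots>, h (t - 1)\<close>, its next query is \<open>query A t u h\<close>. The
  value of \<open>h\<close> outside \<open>{..<t}\<close> is \<open>undefined\<close>, as for elements of \<open>PiM {..<t}\<close>.\<close>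

record ('n::finite) learner =
  seed :: "real measure"
  query :: "nat \<Rightarrow> real \<Rightarrow> (nat \<Rightarrow> 'n point \<times> bool) \<Rightarrow> 'n point"
  learned :: "real \<Rightarrow> (nat \<Rightarrow> 'n point \<times> bool) \<Rightarrow> 'n classifier"

definition learners :: "nat \<Rightarrow> ('n::finite) learner set" where
  "learners n =
     {A. prob_space (seed A) \<and>
        (\<forall>t<n. (\<lambda>(u, h). query A t u h)
           \<in> seed A \<Otimes>\<^sub>M (\<Pi>\<^sub>M i\<in>{..<t}. example_space) \<rightarrow>\<^sub>M cube_space) \<and>
        (\<lambda>((u, h), x). learned A u h x)
           \<in> (seed A \<Otimes>\<^sub>M (\<Pi>\<^sub>M i\<in>{..<n}. example_space)) \<Otimes>\<^sub>M cube_space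
             \<rightarrow>\<^sub>M count_space UNIV}"

text \<open>Law of the first \<open>t\<close> examples given the seed \<open>u\<close>. It has finite support, because given the
  seed each query is a function of the past examples.\<close>

primrec transcript ::
    "('n::finite) learner \<Rightarrow> ('n point \<Rightarrow> real) \<Rightarrow> real \<Rightarrow> nat
      \<Rightarrow> (nat \<Rightarrow> 'n point \<times> bool) pmf" where
  "transcript A \<eta> u 0 = return_pmf (\<lambda>_. undefined)"
| "transcript A \<eta> u (Suc t) =
     bind_pmf (transcript A \<eta> u t) (\<lambda>h.
       let x = query A t u h
       in map_pmf (\<lambda>y. h(t := (x, y))) (bernoulli_pmf (\<eta> x)))"

definition expected_excess_risk ::
    "real \<Rightarrow> nat \<Rightarrow> ('n::finite) learner \<Rightarrow> ('n point \<times> bool) measure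
      \<Rightarrow> ('n point \<Rightarrow> real) \<Rightarrow> real" where
  "expected_excess_risk lam n A P \<eta> =
     (\<integral>u. measure_pmf.expectation (transcript A \<eta> u n)
            (\<lambda>h. risk lam P (learned A u h) - risk lam P (bayes_classifier lam \<eta>)) \<partial>seed A)"

end

theory Submission
  imports Defs
begin

text \<open>Assouad's method with a discrete marginal. Place bumps of radius \<open>r\<close> and height \<open>a\<close> of order
  \<open>r powr \<beta>\<close> on a grid of order \<open>r powr -D\<close> points of the cube. Each bump pushes \<open>\<eta>\<close> above or below the
  threshold \<open>lam\<close>, so it decides whether to abstain at its centre. The marginal has mass
  \<open>a powr \<alpha>0\<close>, spread uniformly over the centres, and an atom where \<open>\<eta>\<close> is near \<open>1/2\<close>. This meets the
  margin condition without any relation between \<open>\<alpha>0\<close>, \<open>\<beta>\<close> and \<open>D\<close>. Since the bumps are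
  disjoint, the \<open>n\<close> queries leave about \<open>n * r powr D\<close> per bump on average, and each of them carries
  information of order \<open>a^2\<close>. With \<open>r\<close> of order \<open>n powr (-1 / (2 * \<beta> + D))\<close> a constant fraction of
  the signs stays undetermined for an average sign pattern, which costs \<open>a powr (1 + \<alpha>0)\<close> up to a constant.\<close>

section \<open>Testing two regression functions\<close>

text \<open>Finite support makes every real function of the transcript integrable for a fixed
  seed.\<close>

lemma finite_set_transcript: "finite (set_pmf (transcript A \<eta> u t))"
  by (induction t) (auto simp: Let_def)

lemma expectation_transcript_Suc:
  fixes F :: "(nat \<Rightarrow> ('n::finite) point \<times> bool) \<Rightarrow> real"
  assumes "\<And>x. 0 \<le> \<eta> x" "\<And>x. \<eta> x \<le> 1"
  shows "measure_pmf.expectation (transcript A \<eta> u (Suc t)) F =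
    measure_pmf.expectation (transcript A \<eta> u t)
      (\<lambda>h. let x = query A t u h in \<eta> x * F (h(t := (x, True))) + (1 - \<eta> x) * F (h(t := (x, False))))"
proof -
  have "measure_pmf.expectation (transcript A \<eta> u (Suc t)) F =
    measure_pmf.expectation (transcript A \<eta> u t)
      (\<lambda>h. measure_pmf.expectation (map_pmf (\<lambda>y. h(t := (query A t u h, y))) (bernoulli_pmf (\<eta> (query A t u h)))) F)"
    unfolding transcript.simps Let_def
    by (subst pmf_expectation_bind[where A = "set_pmf (transcript A \<eta> u t)"])
       (auto simp: finite_set_transcript integral_measure_pmf_real[where A="set_pmf (transcript A \<eta> u t)"] mult.commute)
  then show ?thesis
    by (simp add: assms Let_def mult.commute)
qed

text \<open>Both radicands have the form \<open>x\<^sup>2 - b\<^sup>2\<close>, for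
  \<open>x = s\<close> and \<open>x = 1 - s\<close>. Both values of \<open>x\<close> are at least
  \<open>l\<close>, so each root is at least \<open>x - b\<^sup>2 / l\<close>, and the two values
  add up to \<open>1\<close>.\<close>

lemma affinity_ge:
  fixes s b l :: real
  assumes "0 < l" "l \<le> s" "s \<le> 1/2" "\<bar>b\<bar> \<le> l"
  shows "1 - 2 * b\<^sup>2 / l \<le> sqrt ((s + b) * (s - b)) + sqrt ((1 - (s + b)) * (1 - (s - b)))"
proof -
  have *: "x - b\<^sup>2 / l \<le> sqrt ((x + b) * (x - b))" if "l \<le> x" for x
  proof (cases "x - b\<^sup>2 / l \<le> 0")
    case True
    have "0 \<le> (x + b) * (x - b)"
      using that assms by (intro mult_nonneg_nonneg) auto
    then show ?thesis using True by (meson order_trans real_sqrt_ge_zero)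
  next
    case False
    have "b\<^sup>2 / l * l = b\<^sup>2" using assms by simp
    define y where "y = b\<^sup>2 / l"
    have y: "0 \<le> y" "y * l = b\<^sup>2" "y < x" using assms False by (auto simp: y_def)
    \<comment> \<open>From \<open>y < x\<close> follows
      \<open>2 * x - y \<ge> x \<ge> l\<close>.\<close>
    have "y * (2 * x - y) \<ge> y * l" using y that by (intro mult_left_mono) auto
    then have "(x - y)\<^sup>2 \<le> (x + b) * (x - b)"
      using y by (simp add: power2_eq_square algebra_simps)
    then show ?thesis unfolding y_def by (rule real_le_rsqrt)
  qed
  have e: "(1 - (s + b)) * (1 - (s - b)) = ((1 - s) + b) * ((1 - s) - b)" by (simp add: algebra_simps)
  show ?thesis unfolding e using *[of s] *[of "1 - s"] assms by simp
qed

text \<open>Cauchy-Schwarz for the vectors \<open>(a, b)\<close> and \<open>(c, d)\<close> of square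
  roots. The product conditions then eliminate the test values and leave the affinity of two
  Bernoulli laws.\<close>

lemma bernoulli_product_ge:
  fixes p q F1 F0 G1 G0 :: real
  assumes "0 \<le> p" "p \<le> 1" "0 \<le> q" "q \<le> 1"
    and F: "0 \<le> F1" "0 \<le> F0" "0 \<le> G1" "0 \<le> G0" and FG: "1 \<le> F1 * G1" "1 \<le> F0 * G0"
  shows "sqrt (p * q) + sqrt ((1 - p) * (1 - q)) \<le> sqrt ((p * F1 + (1 - p) * F0) * (q * G1 + (1 - q) * G0))"
proof -
  define a b c d where "a = sqrt (p * F1)" "b = sqrt ((1 - p) * F0)"
     "c = sqrt (q * G1)" "d = sqrt ((1 - q) * G0)"
  have sq: "p * F1 = a\<^sup>2" "(1 - p) * F0 = b\<^sup>2" "q * G1 = c\<^sup>2" "(1 - q) * G0 = d\<^sup>2"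
    and nn: "0 \<le> a" "0 \<le> b" "0 \<le> c" "0 \<le> d"
    using assms by (auto simp: a_b_c_d_def)
  have "p * q * 1 \<le> p * q * (F1 * G1)" "(1 - p) * (1 - q) * 1 \<le> (1 - p) * (1 - q) * (F0 * G0)"
    using assms by (intro mult_left_mono; simp)+
  then have "p * q \<le> (a * c)\<^sup>2" "(1 - p) * (1 - q) \<le> (b * d)\<^sup>2"
    unfolding power_mult_distrib sq[symmetric] by (simp_all add: mult_ac)
  then have "sqrt (p * q) \<le> a * c" "sqrt ((1 - p) * (1 - q)) \<le> b * d"
    using nn by (auto intro: real_le_lsqrt)
  moreover have "a * c + b * d \<le> sqrt ((a\<^sup>2 + b\<^sup>2) * (c\<^sup>2 + d\<^sup>2))"
  proof (rule real_le_rsqrt)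
    have "(a\<^sup>2 + b\<^sup>2) * (c\<^sup>2 + d\<^sup>2) - (a * c + b * d)\<^sup>2 = (a * d - b * c)\<^sup>2"
      by (simp add: power2_eq_square algebra_simps)
    then show "(a * c + b * d)\<^sup>2 \<le> (a\<^sup>2 + b\<^sup>2) * (c\<^sup>2 + d\<^sup>2)"
      by (metis diff_ge_0_iff_ge zero_le_power2)
  qed
  ultimately show ?thesis unfolding sq by linarith
qed

definition visits :: "'a set \<Rightarrow> nat \<Rightarrow> (nat \<Rightarrow> 'a \<times> bool) \<Rightarrow> real" where
  "visits B t h = (\<Sum>i<t. of_bool (fst (h i) \<in> B))"

lemma visits_Suc_upd: "visits B (Suc t) (h(t := z)) = visits B t h + of_bool (fst z \<in> B)"
  by (simp add: visits_def)

text \<open>Up to the visits, half of the left-hand side minimised over \<open>F\<close> and \<open>G\<close> with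
  \<open>F * G \<ge> 1\<close> is the Hellinger affinity of the two transcript laws. This dual form lets the
  induction peel off the last query without mentioning densities: one step turns \<open>(F, G)\<close> into
  conditional means whose product drops below \<open>1\<close> only if the query is in \<open>B\<close>, and then the
  cost \<open>k\<close> added to both functions restores it.\<close>

lemma two_le_expectation_transcripts:
  fixes F G :: "(nat \<Rightarrow> ('n::finite) point \<times> bool) \<Rightarrow> real"
  assumes p: "\<And>x. 0 \<le> p x" "\<And>x. p x \<le> 1" and q: "\<And>x. 0 \<le> q x" "\<And>x. q x \<le> 1"
    and "0 \<le> k" and eq: "\<And>x. x \<notin> B \<Longrightarrow> p x = q x"
    and aff: "\<And>x. 1 - k \<le> sqrt (p x * q x) + sqrt ((1 - p x) * (1 - q x))"
    and F: "\<And>h. 0 \<le> F h" and G: "\<And>h. 0 \<le> G h" and FG: "\<And>h. 1 \<le> F h * G h"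
  shows "2 \<le> measure_pmf.expectation (transcript A p u t) (\<lambda>h. F h + k * visits B t h)
    + measure_pmf.expectation (transcript A q u t) (\<lambda>h. G h + k * visits B t h)"
  using F G FG
proof (induction t arbitrary: F G)
  case 0
  \<comment> \<open>With no queries both laws are the same point mass, so the claim is the AM-GM
    inequality.\<close>
  have "2 \<le> F h + G h" for h
    using order_trans[OF real_sqrt_ge_one[OF "0"(3)[of h]] arith_geo_mean_sqrt[OF "0"(1,2)[of h]]] by simp
  then show ?case by (simp add: visits_def)
next
  case (Suc t)
  define step where "step e H h = (let x = query A t u h in
      e x * H (h(t := (x, True))) + (1 - e x) * H (h(t := (x, False))) + k * of_bool (x \<in> B))"
    for e :: "'n point \<Rightarrow> real" and H :: "(nat \<Rightarrow> 'n point \<times> bool) \<Rightarrow> real" and h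
  have step: "measure_pmf.expectation (transcript A e u (Suc t)) (\<lambda>h. H h + k * visits B (Suc t) h) =
     measure_pmf.expectation (transcript A e u t) (\<lambda>h. step e H h + k * visits B t h)"
    if "\<And>x. 0 \<le> e x" "\<And>x. e x \<le> 1" for e H
    unfolding expectation_transcript_Suc[OF that]
    by (intro Bochner_Integration.integral_cong)
       (simp_all add: step_def visits_Suc_upd Let_def algebra_simps)
  have "2 \<le> measure_pmf.expectation (transcript A p u t) (\<lambda>h. step p F h + k * visits B t h)
    + measure_pmf.expectation (transcript A q u t) (\<lambda>h. step q G h + k * visits B t h)"
  proof (rule Suc.IH)
    fix h
    show nn: "0 \<le> step p F h" "0 \<le> step q G h"
      unfolding step_def Let_def using p q Suc.prems \<open>0 \<le> k\<close> by (auto intro!: add_nonneg_nonneg mult_nonneg_nonneg)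
    define x where "x = query A t u h"
    define F1 F0 G1 G0 where d: "F1 = F (h(t := (x, True)))" "F0 = F (h(t := (x, False)))"
      "G1 = G (h(t := (x, True)))" "G0 = G (h(t := (x, False)))"
    define F' G' where d': "F' = p x * F1 + (1 - p x) * F0" "G' = q x * G1 + (1 - q x) * G0"
    define j where "j = k * of_bool (x \<in> B)"
    have s: "step p F h = F' + j" "step q G h = G' + j"
      by (simp_all add: step_def Let_def d d' x_def[symmetric] j_def)
    have nn': "0 \<le> F'" "0 \<le> G'" "0 \<le> j"
      unfolding d d' j_def using p q Suc.prems \<open>0 \<le> k\<close> by (auto intro!: add_nonneg_nonneg mult_nonneg_nonneg)
    \<comment> \<open>A query outside \<open>B\<close> has affinity exactly \<open>1\<close>, so the
      allowance \<open>k\<close> is spent only on queries in \<open>B\<close>.\<close>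
    have "1 - j \<le> sqrt (p x * q x) + sqrt ((1 - p x) * (1 - q x))"
      using aff[of x] eq[of x] p[of x] q[of x] by (cases "x \<in> B") (auto simp: j_def)
    also have "\<dots> \<le> sqrt (F' * G')"
      unfolding d' by (rule bernoulli_product_ge) (simp_all add: p q d Suc.prems)
    finally have "1 \<le> (sqrt (F' * G') + j)\<^sup>2"
      by simp
    also have "\<dots> = F' * G' + 2 * sqrt (F' * G') * j + j\<^sup>2"
      using nn' by (simp add: power2_sum)
    \<comment> \<open>AM-GM replaces the geometric mean, after which the expression factors as
      \<open>(F' + j) * (G' + j)\<close>.\<close>
    also have "\<dots> \<le> F' * G' + (F' + G') * j + j\<^sup>2"
      using arith_geo_mean_sqrt[OF nn'(1,2)] nn'(3) by (intro add_mono mult_right_mono order_refl) simp_all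
    also have "\<dots> = step p F h * step q G h"
      unfolding s by (simp add: power2_eq_square algebra_simps)
    finally show "1 \<le> step p F h * step q G h" .
  qed
  then show ?case by (simp only: step p q)
qed

text \<open>No test separates \<open>p\<close> from \<open>q\<close> reliably while \<open>k\<close>
  times the expected number of visits to \<open>B\<close> is small. Visits are counted under both
  laws because the queries adapt to the labels.\<close>

lemma two_point_error:
  fixes S :: "(nat \<Rightarrow> ('n::finite) point \<times> bool) set"
  assumes p: "\<And>x. 0 \<le> p x" "\<And>x. p x \<le> 1" and q: "\<And>x. 0 \<le> q x" "\<And>x. q x \<le> 1"
    and "0 \<le> k" and "\<And>x. x \<notin> B \<Longrightarrow> p x = q x"
    and "\<And>x. 1 - k \<le> sqrt (p x * q x) + sqrt ((1 - p x) * (1 - q x))"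
  shows "2/3 * (1 - k * (measure_pmf.expectation (transcript A p u t) (visits B t)
                         + measure_pmf.expectation (transcript A q u t) (visits B t)))
    \<le> measure_pmf.prob (transcript A p u t) S + measure_pmf.prob (transcript A q u t) (- S)"
proof -
  let ?E = "\<lambda>e. measure_pmf.expectation (transcript A e u t)"
  let ?P = "\<lambda>e. measure_pmf.prob (transcript A e u t)"
  have I: "integrable (measure_pmf (transcript A e u t)) f" for e and f :: "_ \<Rightarrow> real"
    by (intro integrable_measure_pmf_finite finite_set_transcript)
  \<comment> \<open>the test functions take the value \<open>2\<close> on the error events and \<open>1/2\<close> elsewhere\<close>
  have "2 \<le> ?E p (\<lambda>h. (1/2 + 3/2 * indicator S h) + k * visits B t h)
     + ?E q (\<lambda>h. (1/2 + 3/2 * indicator (- S) h) + k * visits B t h)"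
    by (rule two_le_expectation_transcripts[OF assms]) (auto simp: indicator_def)
  also have "\<dots> = 1 + 3/2 * (?P p S + ?P q (- S)) + k * (?E p (visits B t) + ?E q (visits B t))"
    by (simp add: I algebra_simps)
  finally show ?thesis by (simp add: field_simps)
qed

section \<open>Discrete instances\<close>

lemma space_cube_space [simp]: "space cube_space = cbox 0 1"
  by (simp add: cube_space_def space_restrict_space)

lemma space_example_space [simp]: "space example_space = cbox 0 1 \<times> UNIV"
  by (simp add: example_space_def space_pair_measure)

text \<open>The measurability conditions in \<open>learners\<close> speak only about product spaces,
  so they apply to a transcript once it is known to lie there.\<close>

lemma set_transcript_subset:
  assumes A: "A \<in> learners n" and u: "u \<in> space (seed A)" and "t \<le> n"
  shows "set_pmf (transcript A \<eta> u t) \<subseteq> space (\<Pi>\<^sub>M i\<in>{..<t}. example_space)"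
  using \<open>t \<le> n\<close>
proof (induction t)
  case (Suc t)
  have "h(t := (query A t u h, y)) \<in> space (\<Pi>\<^sub>M i\<in>{..<Suc t}. example_space)"
    if "h \<in> space (\<Pi>\<^sub>M i\<in>{..<t}. example_space)" for h y
  proof -
    have "(\<lambda>(u, h). query A t u h) \<in> seed A \<Otimes>\<^sub>M (\<Pi>\<^sub>M i\<in>{..<t}. example_space) \<rightarrow>\<^sub>M cube_space"
      using A Suc.prems by (auto simp: learners_def)
    from measurable_space[OF this, of "(u, h)"] have "query A t u h \<in> cbox 0 1"
      using u that by (simp add: space_pair_measure)
    then show ?thesis
      using that by (auto simp: space_PiM PiE_iff extensional_def less_Suc_eq)
  qed
  then show ?case using Suc by (auto simp: Let_def)
qed (simp add: space_PiM)

text \<open>Needed to integrate over the seed. \<open>F\<close> is generalised because averaging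
  over the last label yields a different function of the shorter transcript.\<close>

lemma measurable_expectation_transcript:
  fixes A :: "('n::finite) learner"
  assumes A: "A \<in> learners n" and \<eta>: "\<eta> \<in> borel_measurable cube_space" "\<And>x. 0 \<le> \<eta> x" "\<And>x. \<eta> x \<le> 1"
    and "t \<le> n"
    and "(\<lambda>(u, h). F u h) \<in> borel_measurable (seed A \<Otimes>\<^sub>M (\<Pi>\<^sub>M i\<in>{..<t}. example_space))"
  shows "(\<lambda>u. measure_pmf.expectation (transcript A \<eta> u t) (F u) :: real) \<in> borel_measurable (seed A)"
  using assms(5,6)
proof (induction t arbitrary: F)
  case 0
  \<comment> \<open>The empty product has the single point \<open>\<lambda>_. undefined\<close>, the
    start value of \<open>transcript\<close>.\<close>
  have "(\<lambda>u. (u, \<lambda>_. undefined)) \<in> seed A \<rightarrow>\<^sub>M seed A \<Otimes>\<^sub>M (\<Pi>\<^sub>M i\<in>{..<0::nat}. example_space)"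
    by (intro measurable_Pair measurable_const) (auto simp: space_PiM)
  from measurable_compose[OF this 0(2)] show ?case by simp
next
  case (Suc t)
  let ?M = "seed A \<Otimes>\<^sub>M (\<Pi>\<^sub>M i\<in>{..<t}. example_space)"
  have q: "(\<lambda>z. query A t (fst z) (snd z)) \<in> ?M \<rightarrow>\<^sub>M cube_space"
    using A Suc.prems(1) unfolding case_prod_beta[symmetric] by (simp add: learners_def)
  have upd: "(\<lambda>z. F (fst z) ((snd z)(t := (query A t (fst z) (snd z), b)))) \<in> borel_measurable ?M" for b
  proof -
    have "(\<lambda>z. (snd z)(t := (query A t (fst z) (snd z), b))) \<in> ?M \<rightarrow>\<^sub>M (\<Pi>\<^sub>M i\<in>{..<Suc t}. example_space)"
      using q by (intro measurable_fun_upd[where J = "{..<t}"]) (auto simp: example_space_def)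
    then have "(\<lambda>z. (fst z, (snd z)(t := (query A t (fst z) (snd z), b))))
      \<in> ?M \<rightarrow>\<^sub>M seed A \<Otimes>\<^sub>M (\<Pi>\<^sub>M i\<in>{..<Suc t}. example_space)"
      by measurable
    from measurable_compose[OF this Suc.prems(2)] show ?thesis by simp
  qed
  show ?case
    unfolding expectation_transcript_Suc[OF \<eta>(2,3)] Let_def
  proof (rule Suc.IH)
    show "(\<lambda>(u, h). \<eta> (query A t u h) * F u (h(t := (query A t u h, True)))
        + (1 - \<eta> (query A t u h)) * F u (h(t := (query A t u h, False)))) \<in> borel_measurable ?M"
      unfolding case_prod_beta
      using upd measurable_compose[OF q \<eta>(1)] by (intro borel_measurable_add borel_measurable_times
          borel_measurable_diff borel_measurable_const) auto
  qed (use Suc.prems in auto)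
qed

section \<open>Finitely supported joint laws and their risk\<close>

definition labelled :: "'a pmf \<Rightarrow> ('a \<Rightarrow> real) \<Rightarrow> ('a \<times> bool) pmf" where
  "labelled \<mu> \<eta> = bind_pmf \<mu> (\<lambda>x. map_pmf (Pair x) (bernoulli_pmf (\<eta> x)))"

lemma expectation_labelled:
  fixes f :: "'a \<times> bool \<Rightarrow> real"
  assumes "finite (set_pmf \<mu>)" "\<And>x. 0 \<le> \<eta> x" "\<And>x. \<eta> x \<le> 1"
  shows "measure_pmf.expectation (labelled \<mu> \<eta>) f =
    measure_pmf.expectation \<mu> (\<lambda>x. \<eta> x * f (x, True) + (1 - \<eta> x) * f (x, False))"
  unfolding labelled_def using assms
  by (subst pmf_expectation_bind[where A = "set_pmf \<mu>"])
     (auto simp: integral_measure_pmf_real[where A="set_pmf \<mu>"] mult.commute)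

lemma set_labelled: "fst ` set_pmf (labelled \<mu> \<eta>) \<subseteq> set_pmf \<mu>"
  by (auto simp: labelled_def)

text \<open>A discrete law lives on the power set algebra of the whole type, so it has to be pushed into
  \<open>example_space\<close> by a map that is total into the cube.\<close>

definition discrete_law :: "('n::finite) point pmf \<Rightarrow> ('n point \<Rightarrow> real) \<Rightarrow> ('n point \<times> bool) measure" where
  "discrete_law \<mu> \<eta> = distr (labelled \<mu> \<eta>) example_space (\<lambda>z. if fst z \<in> cbox 0 1 then z else (0, False))"

context
  fixes \<mu> :: "('n::finite) point pmf" and \<eta> :: "'n point \<Rightarrow> real"
  assumes fin: "finite (set_pmf \<mu>)" and cube: "set_pmf \<mu> \<subseteq> cbox 0 1"
    and \<eta>: "\<eta> \<in> borel_measurable cube_space" "\<And>x. 0 \<le> \<eta> x" "\<And>x. \<eta> x \<le> 1"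
begin

lemma sets_discrete_law [simp]: "sets (discrete_law \<mu> \<eta>) = sets example_space"
  by (simp add: discrete_law_def)

lemma space_discrete_law [simp]: "space (discrete_law \<mu> \<eta>) = cbox 0 1 \<times> UNIV"
  by (simp add: discrete_law_def)

lemma measurable_into_cube:
  "(\<lambda>z. if fst z \<in> cbox 0 1 then z else (0, False)) \<in> measure_pmf p \<rightarrow>\<^sub>M (example_space :: ('n point \<times> bool) measure)"
  by (auto simp: mem_box_cart split: if_splits)

lemma prob_space_discrete_law: "prob_space (discrete_law \<mu> \<eta>)"
  unfolding discrete_law_def by (intro measure_pmf.prob_space_distr measurable_into_cube)

lemma integral_discrete_law:
  assumes "f \<in> borel_measurable example_space"
  shows "integral\<^sup>L (discrete_law \<mu> \<eta>) f =
    measure_pmf.expectation \<mu> (\<lambda>x. \<eta> x * f (x, True) + (1 - \<eta> x) * f (x, False) :: real)"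
proof -
  have "integral\<^sup>L (discrete_law \<mu> \<eta>) f = measure_pmf.expectation (labelled \<mu> \<eta>) (\<lambda>z. f (if fst z \<in> cbox 0 1 then z else (0, False)))"
    unfolding discrete_law_def by (rule integral_distr[OF measurable_into_cube assms])
  \<comment> \<open>The support lies over the cube, where the map in \<open>discrete_law\<close> is
    the identity.\<close>
  also have "\<dots> = measure_pmf.expectation (labelled \<mu> \<eta>) f"
    using cube set_labelled[of \<mu> \<eta>] by (intro integral_cong_AE) (auto simp: AE_measure_pmf_iff)
  finally show ?thesis by (simp add: expectation_labelled fin \<eta>)
qed

lemma measurable_fst_discrete_law: "fst \<in> discrete_law \<mu> \<eta> \<rightarrow>\<^sub>M cube_space"
  unfolding measurable_cong_sets[OF sets_discrete_law refl] example_space_def by (rule measurable_fst)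

lemma integral_marginal_discrete_law:
  assumes "f \<in> borel_measurable cube_space"
  shows "integral\<^sup>L (marginal (discrete_law \<mu> \<eta>)) f = (measure_pmf.expectation \<mu> f :: real)"
proof -
  have "integral\<^sup>L (marginal (discrete_law \<mu> \<eta>)) f = integral\<^sup>L (discrete_law \<mu> \<eta>) (\<lambda>z. f (fst z))"
    unfolding marginal_def by (rule integral_distr[OF measurable_fst_discrete_law assms])
  also have "\<dots> = measure_pmf.expectation \<mu> f"
    using measurable_compose[OF measurable_fst assms, of "count_space UNIV"]
    by (subst integral_discrete_law) (simp_all add: example_space_def algebra_simps)
  finally show ?thesis .
qed

lemma measure_discrete_law:
  assumes "S \<in> sets example_space"
  shows "measure (discrete_law \<mu> \<eta>) S =
    measure_pmf.expectation \<mu> (\<lambda>x. \<eta> x * indicator S (x, True) + (1 - \<eta> x) * indicator S (x, False))"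
proof -
  interpret prob_space "discrete_law \<mu> \<eta>" by (rule prob_space_discrete_law)
  have "measure (discrete_law \<mu> \<eta>) S = integral\<^sup>L (discrete_law \<mu> \<eta>) (indicator S)"
    using assms sets.sets_into_space[OF assms] by (simp add: Int_absorb2)
  also have "\<dots> = measure_pmf.expectation \<mu> (\<lambda>x. \<eta> x * indicator S (x, True) + (1 - \<eta> x) * indicator S (x, False))"
    using assms by (intro integral_discrete_law) simp
  finally show ?thesis .
qed

lemma measure_marginal_discrete_law:
  assumes "S \<in> sets cube_space"
  shows "measure (marginal (discrete_law \<mu> \<eta>)) S = measure_pmf.prob \<mu> S"
proof -
  interpret prob_space "marginal (discrete_law \<mu> \<eta>)"
    unfolding marginal_def
    by (intro prob_space.prob_space_distr prob_space_discrete_law measurable_fst_discrete_law)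
  have "S \<in> sets (marginal (discrete_law \<mu> \<eta>))" using assms by (simp add: marginal_def)
  then have "measure (marginal (discrete_law \<mu> \<eta>)) S = integral\<^sup>L (marginal (discrete_law \<mu> \<eta>)) (indicator S)"
    using sets.sets_into_space[OF assms] by (simp add: Int_absorb2)
  also have "\<dots> = measure_pmf.expectation \<mu> (indicator S)"
    using assms by (intro integral_marginal_discrete_law) simp
  finally show ?thesis by simp
qed

lemma regression_function_discrete_law: "regression_function (discrete_law \<mu> \<eta>) \<eta>"
  unfolding regression_function_def
proof (intro conjI ballI \<eta>)
  fix S :: "'n point set" assume S: "S \<in> sets cube_space"
  have "measure (discrete_law \<mu> \<eta>) (S \<times> {True}) = measure_pmf.expectation \<mu> (\<lambda>x. indicator S x * \<eta> x)"
    using S by (subst measure_discrete_law)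
      (auto simp: example_space_def indicator_def intro!: Bochner_Integration.integral_cong)
  also have "\<dots> = set_lebesgue_integral (marginal (discrete_law \<mu> \<eta>)) S \<eta>"
    unfolding set_lebesgue_integral_def using S \<eta>(1) by (subst integral_marginal_discrete_law) simp_all
  finally show "measure (discrete_law \<mu> \<eta>) (S \<times> {True}) = set_lebesgue_integral (marginal (discrete_law \<mu> \<eta>)) S \<eta>" .
qed

end

text \<open>The conditional risk of the decision \<open>d\<close> at a point where the label
  \<open>True\<close> has probability \<open>e\<close>.\<close>

definition loss :: "real \<Rightarrow> real \<Rightarrow> bool option \<Rightarrow> real" where
  "loss lam e d = (case d of None \<Rightarrow> lam | Some y \<Rightarrow> if y then 1 - e else e)"

lemma risk_discrete_law:
  assumes fin: "finite (set_pmf \<mu>)" and cube: "set_pmf \<mu> \<subseteq> cbox 0 1"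
    and \<eta>: "\<eta> \<in> borel_measurable cube_space" "\<And>x. 0 \<le> \<eta> x" "\<And>x. \<eta> x \<le> 1"
    and g: "g \<in> cube_space \<rightarrow>\<^sub>M count_space UNIV"
  shows "risk lam (discrete_law \<mu> \<eta>) g = measure_pmf.expectation \<mu> (\<lambda>x. loss lam (\<eta> x) (g x))"
proof -
  let ?P = "discrete_law \<mu> \<eta>"
  have gm: "(\<lambda>z. g (fst z)) \<in> example_space \<rightarrow>\<^sub>M count_space UNIV"
    unfolding example_space_def by (rule measurable_compose[OF measurable_fst g])
  have sm: "snd \<in> (example_space :: ('a point \<times> bool) measure) \<rightarrow>\<^sub>M count_space UNIV"
    unfolding example_space_def by (rule measurable_snd)
  define S where "S = {z \<in> space example_space. g (fst z) \<noteq> Some (snd z) \<and> g (fst z) \<noteq> None}"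
  have S: "S \<in> sets example_space"
    unfolding S_def using gm sm by measurable
  define N where "N = {x \<in> space cube_space. g x = None}"
  have N: "N \<in> sets cube_space" unfolding N_def using g by measurable
  have I: "integrable (measure_pmf \<mu>) f" for f :: "_ \<Rightarrow> real"
    by (intro integrable_measure_pmf_finite fin)
  have "risk lam ?P g = measure ?P S + lam * measure (marginal ?P) N"
    by (simp add: risk_def S_def N_def space_discrete_law[OF fin cube \<eta>] marginal_def)
  also have "measure (marginal ?P) N = measure_pmf.expectation \<mu> (indicator N)"
    by (simp add: measure_marginal_discrete_law[OF fin cube \<eta> N])
  also have "measure ?P S + lam * measure_pmf.expectation \<mu> (indicator N) = measure_pmf.expectation \<mu>
     (\<lambda>x. (\<eta> x * indicator S (x, True) + (1 - \<eta> x) * indicator S (x, False)) + lam * indicator N x)"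
    by (subst Bochner_Integration.integral_add) (auto simp: I measure_discrete_law[OF fin cube \<eta> S])
  also have "\<dots> = measure_pmf.expectation \<mu> (\<lambda>x. loss lam (\<eta> x) (g x))"
  proof (rule integral_cong_AE)
    show "AE x in \<mu>. (\<eta> x * indicator S (x, True) + (1 - \<eta> x) * indicator S (x, False)) + lam * indicator N x = loss lam (\<eta> x) (g x)"
      using cube by (auto simp: AE_measure_pmf_iff S_def N_def loss_def indicator_def split: option.splits)
  qed auto
  finally show ?thesis .
qed

lemma measurable_bayes_classifier:
  assumes "\<eta> \<in> borel_measurable cube_space"
  shows "bayes_classifier lam \<eta> \<in> cube_space \<rightarrow>\<^sub>M count_space UNIV"
  unfolding bayes_classifier_def using assms by measurable

lemma loss_bayes_classifier_le: "loss lam (\<eta> x) (bayes_classifier lam \<eta> x) \<le> loss lam (\<eta> x) d"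
  by (auto simp: bayes_classifier_def loss_def split: option.splits)

section \<open>Sums of disjoint bumps\<close>

text \<open>Subadditivity of the power function, applied to the smaller number and the
  difference.\<close>

lemma abs_powr_diff_le:
  fixes a b \<beta> :: real
  assumes "0 \<le> a" "0 \<le> b" "0 < \<beta>" "\<beta> \<le> 1"
  shows "\<bar>a powr \<beta> - b powr \<beta>\<bar> \<le> \<bar>a - b\<bar> powr \<beta>"
proof -
  have subadd: "(x + y) powr \<beta> \<le> x powr \<beta> + y powr \<beta>" if "0 \<le> x" "0 \<le> y" for x y :: real
  proof (cases "x + y = 0")
    case False
    then have s: "0 < x + y" using that by simp
    \<comment> \<open>A number in the unit interval is at most its power with exponent
      \<open>\<beta> \<le> 1\<close>. The shares of \<open>x\<close> and \<open>y\<close> in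
      \<open>x + y\<close> sum to \<open>1\<close>.\<close>
    have le: "z / (x + y) \<le> z powr \<beta> / (x + y) powr \<beta>" if "0 \<le> z" "z \<le> x + y" for z
      using powr_mono'[of \<beta> 1 "z / (x + y)"] that s assms by (simp add: powr_divide)
    have "1 = x / (x + y) + y / (x + y)" using s by (simp flip: add_divide_distrib)
    also have "\<dots> \<le> (x powr \<beta> + y powr \<beta>) / (x + y) powr \<beta>"
      using le[of x] le[of y] that by (simp add: add_divide_distrib)
    finally show ?thesis using s by (simp add: le_divide_eq)
  qed (use that in auto)
  show ?thesis
  proof (cases "b \<le> a")
    case True
    then have "b powr \<beta> \<le> a powr \<beta>" using assms by (intro powr_mono2) auto
    then show ?thesis using subadd[of b "a - b"] True assms by simp
  next
    case False
    then have "a powr \<beta> \<le> b powr \<beta>" using assms by (intro powr_mono2) auto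
    then show ?thesis using subadd[of a "b - a"] False assms by simp
  qed
qed

text \<open>For \<open>0 < \<beta> \<le> 1\<close> this cusp has Hoelder constant \<open>1\<close>
  whatever the radius, so shrinking \<open>r\<close> costs no smoothness.\<close>

definition bump :: "real \<Rightarrow> real \<Rightarrow> 'a::real_normed_vector \<Rightarrow> 'a \<Rightarrow> real" where
  "bump \<beta> r z x = max 0 (r powr \<beta> - norm (x - z) powr \<beta>)"

lemma bump_hoelder:
  assumes "0 < \<beta>" "\<beta> \<le> 1"
  shows "\<bar>bump \<beta> r z x - bump \<beta> r z y\<bar> \<le> norm (x - y) powr \<beta>"
proof -
  have "\<bar>norm (x - z) - norm (y - z)\<bar> \<le> norm (x - y)"
    using norm_triangle_ineq3[of "x - z" "y - z"] by simp
  then have "\<bar>norm (x - z) - norm (y - z)\<bar> powr \<beta> \<le> norm (x - y) powr \<beta>"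
    using assms by (intro powr_mono2) auto
  then show ?thesis
    using abs_powr_diff_le[of "norm (x - z)" "norm (y - z)" \<beta>] assms
    unfolding bump_def by auto
qed

lemma bump_nonneg: "0 \<le> bump \<beta> r z x"
  by (simp add: bump_def)

lemma bump_le: "bump \<beta> r z x \<le> r powr \<beta>"
  by (simp add: bump_def)

lemma bump_center: "0 < \<beta> \<Longrightarrow> bump \<beta> r z z = r powr \<beta>"
  by (simp add: bump_def)

lemma bump_eq_0:
  assumes "0 < \<beta>" "0 < r" "x \<notin> ball z r"
  shows "bump \<beta> r z x = 0"
  using assms powr_mono2[of \<beta> r "norm (x - z)"] by (simp add: bump_def dist_norm norm_minus_commute)

definition signed_bumps :: "real \<Rightarrow> real \<Rightarrow> 'a::real_normed_vector set \<Rightarrow> 'a set \<Rightarrow> 'a \<Rightarrow> real" where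
  "signed_bumps \<beta> r K V x = (\<Sum>z\<in>K. (if z \<in> V then 1 else -1) * bump \<beta> r z x)"

lemma card_le_1I:
  assumes "\<And>x y. x \<in> S \<Longrightarrow> y \<in> S \<Longrightarrow> x = y"
  shows "card S \<le> 1"
  by (metis assms card.empty card_1_singleton_iff One_nat_def is_singletonI' is_singleton_def le_numeral_extra(4) zero_le)

section \<open>Bumps on separated centres\<close>

locale separated =
  fixes K :: "('a::real_normed_vector) set" and \<beta> r :: real
  assumes finite_K: "finite K" and K_nonempty: "K \<noteq> {}"
    and separation: "\<And>z w. z \<in> K \<Longrightarrow> w \<in> K \<Longrightarrow> z \<noteq> w \<Longrightarrow> 2 * r \<le> norm (z - w)"
    and \<beta>: "0 < \<beta>" "\<beta> \<le> 1" and r: "0 < r" "r \<le> 1"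
begin

lemma disjoint_balls: "z \<in> K \<Longrightarrow> w \<in> K \<Longrightarrow> x \<in> ball z r \<Longrightarrow> x \<in> ball w r \<Longrightarrow> z = w"
  using separation[of z w] dist_triangle_less_add[of z x r w r]
  by (fastforce simp: dist_norm norm_minus_commute)

lemma card_near_le_1: "card {z \<in> K. x \<in> ball z r} \<le> 1"
  by (rule card_le_1I) (use disjoint_balls in blast)

lemma sum_near_le:
  assumes "\<And>z. z \<in> K \<Longrightarrow> x \<in> ball z r \<Longrightarrow> f z \<le> b" "0 \<le> b"
  shows "(\<Sum>z\<in>{z \<in> K. x \<in> ball z r}. f z) \<le> (b :: real)"
proof -
  have "(\<Sum>z\<in>{z \<in> K. x \<in> ball z r}. f z) \<le> of_nat (card {z \<in> K. x \<in> ball z r}) * b"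
    using assms by (intro sum_bounded_above) auto
  also have "\<dots> \<le> 1 * b"
    using card_near_le_1[of x] assms by (intro mult_right_mono) auto
  finally show ?thesis by simp
qed

lemma abs_signed_bumps_le: "\<bar>signed_bumps \<beta> r K V x\<bar> \<le> r powr \<beta>"
proof -
  have "\<bar>signed_bumps \<beta> r K V x\<bar> \<le> (\<Sum>z\<in>K. bump \<beta> r z x)"
    unfolding signed_bumps_def
    by (rule order_trans[OF sum_abs]) (auto intro!: sum_mono simp: abs_mult bump_nonneg)
  also have "\<dots> = (\<Sum>z\<in>{z \<in> K. x \<in> ball z r}. bump \<beta> r z x)"
    by (rule sum.mono_neutral_right) (use finite_K bump_eq_0[OF \<beta>(1) r(1)] in auto)
  also have "\<dots> \<le> r powr \<beta>"
    by (rule sum_near_le) (auto simp: bump_le)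
  finally show ?thesis .
qed

text \<open>The constant does not grow with the number of centres: at most one bump is nonzero at
  \<open>x\<close> and at most one at \<open>y\<close>, and each contributes
  \<open>1\<close>.\<close>

lemma signed_bumps_hoelder:
  "\<bar>signed_bumps \<beta> r K V x - signed_bumps \<beta> r K V y\<bar> \<le> 2 * norm (x - y) powr \<beta>"
proof -
  let ?N = "\<lambda>x. {z \<in> K. x \<in> ball z r}" and ?d = "\<lambda>z. \<bar>bump \<beta> r z x - bump \<beta> r z y\<bar>"
  have "\<bar>signed_bumps \<beta> r K V x - signed_bumps \<beta> r K V y\<bar> \<le> (\<Sum>z\<in>K. ?d z)"
    unfolding signed_bumps_def sum_subtractf[symmetric]
    by (rule order_trans[OF sum_abs]) (auto intro!: sum_mono)
  also have "\<dots> = (\<Sum>z\<in>?N x \<union> ?N y. ?d z)"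
  proof (rule sum.mono_neutral_right)
    have "?d z = 0" if "x \<notin> ball z r" "y \<notin> ball z r" for z
      using that by (simp add: bump_eq_0[OF \<beta>(1) r(1)] del: mem_ball)
    then show "\<forall>z\<in>K - (?N x \<union> ?N y). ?d z = 0" by blast
  qed (use finite_K in auto)
  also have "\<dots> \<le> (\<Sum>z\<in>?N x. ?d z) + (\<Sum>z\<in>?N y. ?d z)"
    using finite_K by (subst sum.union_inter[symmetric]) (auto intro!: sum_nonneg)
  also have "\<dots> \<le> norm (x - y) powr \<beta> + norm (x - y) powr \<beta>"
    using bump_hoelder[OF \<beta>] by (intro add_mono sum_near_le) auto
  finally show ?thesis by simp
qed

lemma signed_bumps_center:
  assumes "z \<in> K"
  shows "signed_bumps \<beta> r K V z = (if z \<in> V then 1 else -1) * r powr \<beta>"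
proof -
  have "bump \<beta> r w z = 0" if "w \<in> K - {z}" for w
    using that assms disjoint_balls[of w z z] r by (intro bump_eq_0 \<beta> r) auto
  then have "signed_bumps \<beta> r K V z = (\<Sum>w\<in>{z}. (if w \<in> V then 1 else -1) * bump \<beta> r w z)"
    unfolding signed_bumps_def using finite_K assms by (intro sum.mono_neutral_right) auto
  then show ?thesis by (simp add: bump_center \<beta>)
qed

lemma signed_bumps_cong:
  assumes "\<And>w. w \<in> K \<Longrightarrow> x \<in> ball w r \<Longrightarrow> (w \<in> V) = (w \<in> W)"
  shows "signed_bumps \<beta> r K V x = signed_bumps \<beta> r K W x"
  unfolding signed_bumps_def
  by (intro sum.cong) (use assms bump_eq_0[OF \<beta>(1) r(1)] in force)+

text \<open>Only the bump at \<open>z\<close> is nonzero on its ball. There the two patterns lie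
  symmetrically about the base, the form that \<open>affinity_ge\<close> expects.\<close>

lemma signed_bumps_flip:
  assumes "z \<in> K" "z \<notin> V" "x \<in> ball z r"
  shows "signed_bumps \<beta> r K (insert z V) x = - signed_bumps \<beta> r K V x"
proof -
  have "bump \<beta> r w x = 0" if "w \<in> K - {z}" for w
    using that assms disjoint_balls[of w z x] by (intro bump_eq_0 \<beta> r) auto
  then have "signed_bumps \<beta> r K W x = (\<Sum>w\<in>{z}. (if w \<in> W then 1 else -1) * bump \<beta> r w x)" for W
    unfolding signed_bumps_def using finite_K assms by (intro sum.mono_neutral_right) auto
  then show ?thesis using assms by simp
qed

end

lemma borel_measurable_signed_bumps [measurable]:
  "signed_bumps \<beta> r K V \<in> borel_measurable (borel :: (real ^ 'n::finite) measure)"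
  unfolding signed_bumps_def bump_def by measurable

section \<open>The hard instances\<close>

text \<open>\<open>K_half\<close> keeps the centres where the base equals \<open>lam\<close>; the
  base rises along coordinate \<open>i\<close>. The bounds on \<open>c\<close> keep the regression
  function in the unit interval and its value at the atom far from both thresholds.\<close>

locale hard_instances = separated K \<beta> r for K :: "('n::finite) point set" and \<beta> r +
  fixes i :: 'n and lam \<alpha>0 c :: real
  assumes K_cube: "K \<subseteq> cbox 0 1" and K_half: "\<And>z. z \<in> K \<Longrightarrow> z $ i \<le> 1 / 2"
    and lam: "0 < lam" "lam < 1 / 2" and \<alpha>0: "0 < \<alpha>0"
    and c: "0 < c" "c \<le> lam / 4" "c \<le> (1 / 2 - lam) / 4"
begin

definition height :: real where "height = c * r powr \<beta>"

text \<open>The base rises from \<open>lam\<close> on the centres to \<open>1 / 2\<close>, which is far from both thresholds, at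
  the point \<open>1\<close>. Clipping the coordinate keeps \<open>reg\<close> in the unit interval outside the cube
  too.\<close>

definition base :: "'n point \<Rightarrow> real" where
  "base x = lam + (1 - 2 * lam) * max 0 (min 1 (x $ i) - 1 / 2)"

definition reg :: "'n point set \<Rightarrow> 'n point \<Rightarrow> real" where
  "reg V x = base x + c * signed_bumps \<beta> r K V x"

definition design :: "'n point pmf" where
  "design = bind_pmf (bernoulli_pmf (height powr \<alpha>0)) (\<lambda>b. if b then pmf_of_set K else return_pmf 1)"

definition law :: "'n point set \<Rightarrow> ('n point \<times> bool) measure" where
  "law V = discrete_law design (reg V)"

lemma height: "0 < height" "height \<le> c"
  using c r \<beta> powr_mono2[of \<beta> r 1] by (auto simp: height_def)

lemma mass: "0 < height powr \<alpha>0" "height powr \<alpha>0 \<le> 1"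
  using height c lam \<alpha>0 by (auto intro!: powr_le1)

lemma base: "lam \<le> base x" "base x \<le> 1 / 2"
proof -
  show "lam \<le> base x" using lam by (simp add: base_def)
  have "(1 - 2 * lam) * max 0 (min 1 (x $ i) - 1 / 2) \<le> (1 - 2 * lam) * (1 / 2)"
    using lam by (intro mult_left_mono) (auto simp: max_def min_def)
  then show "base x \<le> 1 / 2" by (simp add: base_def)
qed

lemma abs_reg_base_le: "\<bar>reg V x - base x\<bar> \<le> height"
  using mult_left_mono[OF abs_signed_bumps_le[of V x], of c] c
  by (simp add: reg_def height_def abs_mult)

lemma reg_bounds: "0 \<le> reg V x" "reg V x \<le> 1"
  using abs_reg_base_le[of V x] base[of x] height c lam by linarith+

lemma reg_measurable: "reg V \<in> borel_measurable cube_space"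
  unfolding cube_space_def reg_def base_def
  by (intro measurable_restrict_space1) measurable

lemma reg_center: "z \<in> K \<Longrightarrow> reg V z = (if z \<in> V then lam + height else lam - height)"
  using K_half[of z] by (simp add: reg_def base_def signed_bumps_center height_def)

lemma base_hoelder: "\<bar>base x - base y\<bar> \<le> norm (x - y) powr \<beta>"
proof -
  define s where "s = \<bar>max 0 (min 1 (x $ i) - 1 / 2) - max 0 (min 1 (y $ i) - 1 / 2)\<bar>"
  have s: "0 \<le> s" "s \<le> 1" "s \<le> \<bar>(x - y) $ i\<bar>" by (auto simp: s_def)
  have "\<bar>base x - base y\<bar> = (1 - 2 * lam) * s"
    using lam by (simp add: base_def s_def abs_mult flip: right_diff_distrib)
  also have "\<dots> \<le> 1 * s" using s lam by (intro mult_right_mono) auto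
  \<comment> \<open>Increments of at most \<open>1\<close> turn a Lipschitz bound into a Hoelder
    bound.\<close>
  also have "1 * s \<le> s powr \<beta>" using powr_mono'[of \<beta> 1 s] s \<beta> by simp
  also have "\<dots> \<le> norm (x - y) powr \<beta>"
    using s \<beta> component_le_norm_cart[of "x - y" i] by (intro powr_mono2) auto
  finally show ?thesis .
qed

text \<open>The number \<open>3\<close> is \<open>1\<close> for the base plus \<open>2\<close> for
  the bumps, whose factor \<open>c\<close> is below \<open>1\<close>.\<close>

lemma reg_hoelder: "3 \<le> L \<Longrightarrow> hoelder L \<beta> (reg V)"
  unfolding hoelder_def
proof (intro ballI)
  fix x y assume "3 \<le> L"
  have "\<bar>reg V x - reg V y\<bar> \<le> \<bar>base x - base y\<bar> + c * \<bar>signed_bumps \<beta> r K V x - signed_bumps \<beta> r K V y\<bar>"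
  proof -
    have "reg V x - reg V y = (base x - base y) + c * (signed_bumps \<beta> r K V x - signed_bumps \<beta> r K V y)"
      by (simp add: reg_def algebra_simps)
    then show ?thesis using c abs_triangle_ineq[of "base x - base y" "c * (signed_bumps \<beta> r K V x - signed_bumps \<beta> r K V y)"]
      by (simp add: abs_mult)
  qed
  also have "\<dots> \<le> norm (x - y) powr \<beta> + 1 * (2 * norm (x - y) powr \<beta>)"
    using base_hoelder signed_bumps_hoelder c lam by (intro add_mono mult_mono) auto
  also have "\<dots> \<le> L * norm (x - y) powr \<beta>"
    using mult_right_mono[OF \<open>3 \<le> L\<close>, of "norm (x - y) powr \<beta>"] by simp
  finally show "\<bar>reg V x - reg V y\<bar> \<le> L * norm (x - y) powr \<beta>" .
qed

lemma set_design: "set_pmf design \<subseteq> insert 1 K"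
  by (auto simp: design_def set_pmf_of_set[OF K_nonempty finite_K] split: if_splits)

lemma finite_design: "finite (set_pmf design)"
  using set_design finite_K by (meson finite_insert finite_subset)

lemma design_cube: "set_pmf design \<subseteq> cbox 0 1"
  using set_design K_cube by (auto simp: mem_box_cart)

lemma expectation_design:
  "measure_pmf.expectation design f =
     height powr \<alpha>0 * ((\<Sum>z\<in>K. f z) / card K) + (1 - height powr \<alpha>0) * (f 1 :: real)"
  unfolding design_def using mass finite_K K_nonempty
  by (subst pmf_expectation_bind[where A = UNIV]) (auto simp: integral_pmf_of_set UNIV_bool)

lemmas design_reg = finite_design design_cube reg_measurable reg_bounds

text \<open>Three regimes: below \<open>height\<close> the band is null, up to \<open>d\<close> it
  can contain only the centres, of total mass \<open>height powr \<alpha>0\<close>, and from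
  \<open>d\<close> on the right-hand side is at least \<open>1\<close>. The constant depends on
  neither \<open>r\<close> nor \<open>K\<close>.\<close>

lemma margin_law: "margin_with (((1 / 2 - lam) / 2) powr - \<alpha>0) \<alpha>0 lam (law V) (reg V)"
  unfolding margin_with_def
proof (intro allI impI ballI)
  fix t \<gamma> :: real assume t: "0 < t \<and> t \<le> 1" and \<gamma>: "\<gamma> \<in> {lam, 1 - lam}"
  define d where "d = (1 / 2 - lam) / 2"
  have d: "0 < d" "d \<le> 1" using lam by (auto simp: d_def)
  \<comment> \<open>For the threshold \<open>1 - lam\<close> the distance is at least
    \<open>1 - 2 * lam - height\<close>, which the bounds on \<open>c\<close> keep above
    \<open>height\<close>.\<close>
  have near: "height \<le> \<bar>reg V z - \<gamma>\<bar>" if "z \<in> K" for z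
    using \<gamma> reg_center[OF that, of V] height c lam by (auto split: if_splits)
  have far: "d \<le> \<bar>reg V 1 - \<gamma>\<bar>"
  proof -
    have "base 1 = 1 / 2" by (simp add: base_def field_simps)
    then have "1 / 2 - height \<le> reg V 1" "reg V 1 \<le> 1 / 2 + height"
      using abs_reg_base_le[of V 1] by (simp_all add: abs_le_iff)
    then have "d \<le> reg V 1 - lam" "d \<le> (1 - lam) - reg V 1"
      using height c lam by (simp_all add: d_def field_simps)
    then show ?thesis using \<gamma> by auto
  qed
  define S where "S = {x \<in> space cube_space. \<bar>reg V x - \<gamma>\<bar> \<le> t}"
  have S: "S \<in> sets cube_space" unfolding S_def using reg_measurable by measurable
  have prob: "measure_pmf.prob design S = measure_pmf.expectation design (indicator S)"
    by simp
  have C: "1 \<le> d powr - \<alpha>0" using d \<alpha>0 by (simp add: ge_one_powr_ge_zero powr_minus_divide powr_le1)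
  consider "t < d" "t < height" | "t < d" "height \<le> t" | "d \<le> t" by linarith
  then have "measure_pmf.prob design S \<le> d powr - \<alpha>0 * t powr \<alpha>0"
  proof cases
    case 1
    have "1 \<notin> S" using 1 far by (auto simp: S_def)
    moreover have "K \<inter> S = {}" using 1 near by (fastforce simp: S_def)
    ultimately have "measure_pmf.prob design S = 0"
      unfolding prob expectation_design by (auto simp: indicator_def finite_K)
    then show ?thesis by simp
  next
    case 2
    then have "1 \<notin> S" using far by (auto simp: S_def)
    have "(\<Sum>z\<in>K. indicator S z :: real) \<le> of_nat (card K) * 1"
      by (intro sum_bounded_above) (auto simp: indicator_def)
    then have "(\<Sum>z\<in>K. indicator S z :: real) / card K \<le> 1"
      using finite_K K_nonempty by (simp add: divide_le_eq card_gt_0_iff)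
    then have "height powr \<alpha>0 * ((\<Sum>z\<in>K. indicator S z) / card K) \<le> height powr \<alpha>0 * 1"
      by (rule mult_left_mono) simp
    then have "measure_pmf.prob design S \<le> height powr \<alpha>0 * 1"
      unfolding prob expectation_design using \<open>1 \<notin> S\<close> by simp
    also have "\<dots> \<le> t powr \<alpha>0 * 1" using 2 height \<alpha>0 by (intro mult_right_mono powr_mono2) auto
    also have "\<dots> \<le> t powr \<alpha>0 * d powr - \<alpha>0" using C by (intro mult_left_mono) auto
    finally show ?thesis by (simp add: mult.commute)
  next
    case 3
    have "measure_pmf.prob design S \<le> 1" by simp
    also have "1 = d powr - \<alpha>0 * d powr \<alpha>0" using d by (simp add: powr_minus)
    also have "\<dots> \<le> d powr - \<alpha>0 * t powr \<alpha>0"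
      using d 3 \<alpha>0 by (intro mult_left_mono powr_mono2) auto
    finally show ?thesis .
  qed
  then show "measure (marginal (law V)) {x \<in> space (marginal (law V)). \<bar>reg V x - \<gamma>\<bar> \<le> t}
      \<le> ((1 / 2 - lam) / 2) powr - \<alpha>0 * t powr \<alpha>0"
    using measure_marginal_discrete_law[OF design_reg S] 
    by (simp add: S_def law_def d_def marginal_def)
qed

lemma law_in_instances:
  "3 \<le> L \<Longrightarrow> (law V, reg V) \<in> instances_with (((1 / 2 - lam) / 2) powr - \<alpha>0) L \<beta> \<alpha>0 lam"
  using margin_law reg_hoelder prob_space_discrete_law[OF design_reg]
    regression_function_discrete_law[OF design_reg] sets_discrete_law[OF design_reg]
  by (simp add: instances_with_def law_def)

text \<open>The excess risk when \<open>g\<close> is measurable. As a finite average it obeys the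
  bounds below for every \<open>g\<close>, hence for all values of the transcript argument.\<close>

definition excess :: "'n point set \<Rightarrow> 'n classifier \<Rightarrow> real" where
  "excess V g = measure_pmf.expectation design
     (\<lambda>x. loss lam (reg V x) (g x) - loss lam (reg V x) (bayes_classifier lam (reg V) x))"

lemma integrable_design: "integrable (measure_pmf design) (f :: _ \<Rightarrow> real)"
  by (intro integrable_measure_pmf_finite finite_design)

lemma risk_diff_law:
  assumes "g \<in> cube_space \<rightarrow>\<^sub>M count_space UNIV"
  shows "risk lam (law V) g - risk lam (law V) (bayes_classifier lam (reg V)) = excess V g"
  unfolding law_def excess_def risk_discrete_law[OF design_reg assms]
    risk_discrete_law[OF design_reg measurable_bayes_classifier[OF reg_measurable]]
  by (simp add: integrable_design)

text \<open>At a centre the best decision is to abstain if \<open>z \<in> V\<close> and to answer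
  \<open>False\<close> otherwise. Choosing wrongly between abstaining and answering costs at least
  \<open>height\<close>, and the atom contributes a nonnegative term.\<close>

lemma excess_ge:
  "height powr \<alpha>0 * height / card K * (\<Sum>z\<in>K. of_bool ((g z = None) \<noteq> (z \<in> V))) \<le> excess V g"
proof -
  let ?l = "\<lambda>x. loss lam (reg V x) (g x) - loss lam (reg V x) (bayes_classifier lam (reg V) x)"
  have "height * of_bool ((g z = None) \<noteq> (z \<in> V)) \<le> ?l z" if z: "z \<in> K" for z
  proof -
    \<comment> \<open>An explicit decision serves as comparator, which avoids evaluating the Bayes
      classifier.\<close>
    have "loss lam (reg V z) (bayes_classifier lam (reg V) z)
      \<le> loss lam (reg V z) (if z \<in> V then None else Some False)"
      by (rule loss_bayes_classifier_le)
    moreover have "height * of_bool ((g z = None) \<noteq> (z \<in> V))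
       \<le> loss lam (reg V z) (g z) - loss lam (reg V z) (if z \<in> V then None else Some False)"
      using reg_center[OF z, of V] height c lam by (auto simp: loss_def split: option.splits)
    ultimately show ?thesis by linarith
  qed
  then have "height * (\<Sum>z\<in>K. of_bool ((g z = None) \<noteq> (z \<in> V))) \<le> (\<Sum>z\<in>K. ?l z)"
    unfolding sum_distrib_left by (rule sum_mono)
  then have "height powr \<alpha>0 * (height * (\<Sum>z\<in>K. of_bool ((g z = None) \<noteq> (z \<in> V))) / card K)
      \<le> height powr \<alpha>0 * ((\<Sum>z\<in>K. ?l z) / card K)"
    using mass by (intro mult_left_mono divide_right_mono) auto
  moreover have "0 \<le> (1 - height powr \<alpha>0) * ?l 1"
    using mass by (intro mult_nonneg_nonneg) (auto simp: loss_bayes_classifier_le)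
  ultimately show ?thesis by (simp add: excess_def expectation_design)
qed

lemma excess_bounds: "0 \<le> excess V g" "excess V g \<le> 1"
proof -
  show "0 \<le> excess V g"
    unfolding excess_def by (intro Bochner_Integration.integral_nonneg) (simp add: loss_bayes_classifier_le)
  have l: "0 \<le> loss lam (reg V x) d \<and> loss lam (reg V x) d \<le> 1" for x d
    using reg_bounds[of V x] lam by (auto simp: loss_def split: option.splits)
  have "excess V g \<le> measure_pmf.expectation design (\<lambda>_. 1)"
    unfolding excess_def
  proof (intro integral_mono integrable_design)
    fix x show "loss lam (reg V x) (g x) - loss lam (reg V x) (bayes_classifier lam (reg V) x) \<le> 1"
      using l[of x "g x"] l[of x "bayes_classifier lam (reg V) x"] by linarith
  qed
  then show "excess V g \<le> 1" by simp
qed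

end

section \<open>Averaging over sign patterns\<close>

lemma sum_Pow_remove:
  fixes f :: "'a set \<Rightarrow> real"
  assumes "finite K" "z \<in> K"
  shows "(\<Sum>V\<in>Pow K. f V) = (\<Sum>V\<in>Pow (K - {z}). f V + f (insert z V))"
proof -
  have "Pow K = Pow (K - {z}) \<union> insert z ` Pow (K - {z})"
    using assms(2) Pow_insert[of z "K - {z}"] by (simp add: insert_absorb)
  moreover have "Pow (K - {z}) \<inter> insert z ` Pow (K - {z}) = {}" by auto
  moreover have "inj_on (insert z) (Pow (K - {z}))" by (auto simp: inj_on_def)
  ultimately show ?thesis
    using assms(1) by (simp add: sum.union_disjoint sum.reindex sum.distrib)
qed

context hard_instances
begin

text \<open>Off the ball of \<open>z\<close> the two functions coincide. On it they are
  \<open>base x\<close> plus and minus a shift of at most \<open>height\<close>, with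
  \<open>base x \<ge> lam\<close>.\<close>

lemma reg_affinity:
  assumes "z \<in> K" "z \<notin> V"
  shows "1 - 2 * height\<^sup>2 / lam \<le> sqrt (reg V x * reg (insert z V) x)
    + sqrt ((1 - reg V x) * (1 - reg (insert z V) x))"
proof (cases "x \<in> ball z r")
  case True
  define b where "b = reg V x - base x"
  have *: "reg V x = base x + b" "reg (insert z V) x = base x - b"
    using signed_bumps_flip[OF assms True] by (auto simp: b_def reg_def)
  have b: "\<bar>b\<bar> \<le> height" using abs_reg_base_le[of V x] by (simp add: b_def)
  have "1 - 2 * height\<^sup>2 / lam \<le> 1 - 2 * b\<^sup>2 / lam"
    using abs_le_square_iff[of b height] b height lam by (simp add: divide_right_mono)
  also have "\<dots> \<le> sqrt ((base x + b) * (base x - b)) + sqrt ((1 - (base x + b)) * (1 - (base x - b)))"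
    using base[of x] b height c lam by (intro affinity_ge) auto
  finally show ?thesis unfolding * .
next
  case False
  then have "reg (insert z V) x = reg V x"
    unfolding reg_def by (subst signed_bumps_cong[of x "insert z V" V]) auto
  then show ?thesis using reg_bounds[of V x] lam by simp
qed

text \<open>The balls are disjoint, so each query informs about at most one sign; the
  \<open>n\<close> queries are a budget shared by all centres.\<close>

lemma sum_visits_le: "(\<Sum>z\<in>K. visits (ball z r) n h) \<le> real n"
proof -
  have "(\<Sum>z\<in>K. visits (ball z r) n h) = (\<Sum>j<n. \<Sum>z\<in>K. of_bool (fst (h j) \<in> ball z r))"
    unfolding visits_def by (rule sum.swap)
  also have "\<dots> = (\<Sum>j<n. real (card {z \<in> K. fst (h j) \<in> ball z r}))"
    using finite_K by (simp add: of_bool_def sum.If_cases Int_def conj_commute)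
  also have "\<dots> \<le> of_nat (card {..<n}) * 1"
    using card_near_le_1 by (intro sum_bounded_above) (metis of_nat_1 of_nat_le_iff)
  finally show ?thesis by simp
qed

text \<open>Assouad's argument for a fixed seed: for each centre, patterns are paired by their sign
  there and \<open>two_point_error\<close> bounds each pair. Summation over the centres then invokes
  the shared query budget.\<close>

lemma sum_errors_ge:
  assumes budget: "2 * height\<^sup>2 / lam * real n \<le> card K / 4"
  shows "2 ^ card K * (card K / 6) \<le> (\<Sum>V\<in>Pow K. \<Sum>z\<in>K.
     measure_pmf.prob (transcript A (reg V) u n) {h. (learned A u h z = None) \<noteq> (z \<in> V)})"
proof -
  define k where "k = 2 * height\<^sup>2 / lam"
  let ?m = "card K" and ?T = "\<lambda>V. transcript A (reg V) u n"
  let ?N = "\<lambda>V z. measure_pmf.expectation (?T V) (visits (ball z r) n)"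
  let ?e = "\<lambda>V z. measure_pmf.prob (?T V) {h. (learned A u h z = None) \<noteq> (z \<in> V)}"
  have k: "0 \<le> k" using lam by (simp add: k_def)
  have N: "(\<Sum>z\<in>K. ?N V z) \<le> real n" for V
  proof -
    have I: "integrable (measure_pmf (?T V)) (f :: _ \<Rightarrow> real)" for f
      by (intro integrable_measure_pmf_finite finite_set_transcript)
    have "(\<Sum>z\<in>K. ?N V z) = measure_pmf.expectation (?T V) (\<lambda>h. \<Sum>z\<in>K. visits (ball z r) n h)"
      by (simp add: I)
    also have "\<dots> \<le> measure_pmf.expectation (?T V) (\<lambda>_. real n)"
      by (intro integral_mono I sum_visits_le)
    finally show ?thesis by simp
  qed
  \<comment> \<open>The budget takes at most \<open>?m / 4\<close> from \<open>?m / 2\<close>, and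
    two thirds of the rest is \<open>?m / 6\<close>.\<close>
  have "2 ^ ?m * (?m / 6) \<le> 2 / 3 * 2 ^ ?m * (?m / 2 - k * n)"
  proof -
    have "2 / 3 * 2 ^ ?m * (?m / 4) \<le> 2 / 3 * 2 ^ ?m * (?m / 2 - k * n)"
      using budget by (intro mult_left_mono) (auto simp: k_def)
    then show ?thesis by simp
  qed
  also have "\<dots> = 2 / 3 * ((\<Sum>z\<in>K. 2 ^ (?m - 1)) - k * (\<Sum>V\<in>Pow K. real n))"
  proof -
    have "(2 :: real) ^ ?m = 2 * 2 ^ (?m - 1)"
      using finite_K K_nonempty by (metis card_gt_0_iff power_eq_if not_gr_zero)
    then show ?thesis using finite_K by (simp add: card_Pow field_simps)
  qed
  also have "\<dots> \<le> 2 / 3 * ((\<Sum>z\<in>K. 2 ^ (?m - 1)) - k * (\<Sum>V\<in>Pow K. \<Sum>z\<in>K. ?N V z))"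
    using k N by (intro mult_left_mono diff_mono sum_mono) auto
  also have "\<dots> = (\<Sum>z\<in>K. 2 / 3 * (2 ^ (?m - 1) - k * (\<Sum>V\<in>Pow K. ?N V z)))"
    by (subst sum.swap) (simp add: sum_distrib_left sum_subtractf right_diff_distrib)
  also have "\<dots> \<le> (\<Sum>z\<in>K. \<Sum>V\<in>Pow K. ?e V z)"
  proof (rule sum_mono)
    fix z assume z: "z \<in> K"
    have "2 / 3 * (2 ^ (?m - 1) - k * (\<Sum>V\<in>Pow K. ?N V z))
      = (\<Sum>V\<in>Pow (K - {z}). 2 / 3 * (1 - k * (?N V z + ?N (insert z V) z)))"
      unfolding sum_Pow_remove[OF finite_K z] sum_distrib_left[symmetric] sum_subtractf
      using finite_K z by (simp add: card_Pow)
    also have "\<dots> \<le> (\<Sum>V\<in>Pow (K - {z}). ?e V z + ?e (insert z V) z)"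
    proof (rule sum_mono)
      fix V assume "V \<in> Pow (K - {z})"
      then have V: "z \<notin> V" by auto
      have "2 / 3 * (1 - k * (?N V z + ?N (insert z V) z))
        \<le> measure_pmf.prob (?T V) {h. learned A u h z = None} + measure_pmf.prob (?T (insert z V)) (- {h. learned A u h z = None})"
      proof (rule two_point_error[OF reg_bounds reg_bounds k])
        show "reg V x = reg (insert z V) x" if "x \<notin> ball z r" for x
          unfolding reg_def using that by (subst signed_bumps_cong[of x "insert z V" V]) auto
        show "1 - k \<le> sqrt (reg V x * reg (insert z V) x) + sqrt ((1 - reg V x) * (1 - reg (insert z V) x))" for x
          unfolding k_def by (rule reg_affinity[OF z V])
      qed
      \<comment> \<open>Abstaining at \<open>z\<close> is the error under \<open>V\<close> and
        answering is the error under \<open>insert z V\<close>, so one event and its complement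
        cover both.\<close>
      also have "\<dots> = ?e V z + ?e (insert z V) z" using V by (simp add: Compl_eq)
      finally show "2 / 3 * (1 - k * (?N V z + ?N (insert z V) z)) \<le> ?e V z + ?e (insert z V) z" .
    qed
    also have "\<dots> = (\<Sum>V\<in>Pow K. ?e V z)"
      by (rule sum_Pow_remove[OF finite_K z, symmetric])
    finally show "2 / 3 * (2 ^ (?m - 1) - k * (\<Sum>V\<in>Pow K. ?N V z)) \<le> (\<Sum>V\<in>Pow K. ?e V z)" .
  qed
  also have "\<dots> = (\<Sum>V\<in>Pow K. \<Sum>z\<in>K. ?e V z)" by (rule sum.swap)
  finally show ?thesis .
qed

text \<open>Only the values of the classifier at the finitely many points of \<open>K\<close> and at
  \<open>1\<close> enter, so sections of the jointly measurable map suffice.\<close>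

lemma measurable_excess_learned:
  assumes A: "A \<in> learners n"
  shows "(\<lambda>(u, h). excess V (learned A u h)) \<in> borel_measurable (seed A \<Otimes>\<^sub>M (\<Pi>\<^sub>M i\<in>{..<n}. example_space))"
proof -
  let ?M = "seed A \<Otimes>\<^sub>M (\<Pi>\<^sub>M i\<in>{..<n}. example_space)"
  have L: "(\<lambda>((u, h), x). learned A u h x) \<in> ?M \<Otimes>\<^sub>M cube_space \<rightarrow>\<^sub>M count_space UNIV"
    using A by (simp add: learners_def)
  have "(\<lambda>z. loss lam e (learned A (fst z) (snd z) x)) \<in> borel_measurable ?M" if "x \<in> cbox 0 1" for x e
  proof -
    have "(\<lambda>z. (z, x)) \<in> ?M \<rightarrow>\<^sub>M ?M \<Otimes>\<^sub>M cube_space"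
      using that by (intro measurable_Pair measurable_ident measurable_const) auto
    from measurable_compose[OF measurable_compose[OF this L], of "loss lam e"]
    show ?thesis by (simp add: case_prod_beta)
  qed
  moreover have "1 \<in> cbox 0 (1 :: 'n point)" by (simp add: mem_box_cart)
  ultimately show ?thesis
    unfolding excess_def expectation_design case_prod_beta
    using K_cube by (intro borel_measurable_add borel_measurable_times borel_measurable_const
        borel_measurable_divide borel_measurable_sum borel_measurable_diff) auto
qed

text \<open>The sum over patterns is bounded for every seed and integrated before a pattern is
  chosen, so one \<open>V\<close> serves the randomised learner as a whole.\<close>

lemma exists_hard_instance:
  assumes A: "A \<in> learners n" and budget: "2 * height\<^sup>2 / lam * real n \<le> card K / 4"
  shows "\<exists>V. height powr (1 + \<alpha>0) / 6 \<le> expected_excess_risk lam n A (law V) (reg V)"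
proof -
  interpret prob_space "seed A" using A by (simp add: learners_def)
  let ?E = "\<lambda>V u. measure_pmf.expectation (transcript A (reg V) u n)"
  define f where "f V u = ?E V u (\<lambda>h. excess V (learned A u h))" for V u
  have IT: "integrable (measure_pmf (transcript A (reg V) u n)) (g :: _ \<Rightarrow> real)" for g V u
    by (intro integrable_measure_pmf_finite finite_set_transcript)
  have excess_eq: "expected_excess_risk lam n A (law V) (reg V) = (\<integral>u. f V u \<partial>seed A)" for V
    unfolding expected_excess_risk_def f_def
  proof (rule Bochner_Integration.integral_cong[OF refl])
    fix u assume u: "u \<in> space (seed A)"
    have L: "(\<lambda>((u, h), x). learned A u h x)
        \<in> (seed A \<Otimes>\<^sub>M (\<Pi>\<^sub>M i\<in>{..<n}. example_space)) \<Otimes>\<^sub>M cube_space \<rightarrow>\<^sub>M count_space UNIV"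
      using A by (simp add: learners_def)
    \<comment> \<open>Passing from the risk to \<open>excess\<close> requires a measurable
      classifier, which is guaranteed for transcripts in the product space.\<close>
    have "AE h in transcript A (reg V) u n. risk lam (law V) (learned A u h)
        - risk lam (law V) (bayes_classifier lam (reg V)) = excess V (learned A u h)"
      unfolding AE_measure_pmf_iff
    proof
      fix h assume "h \<in> set_pmf (transcript A (reg V) u n)"
      then have "h \<in> space (\<Pi>\<^sub>M i\<in>{..<n}. example_space)"
        using set_transcript_subset[OF A u] by blast
      then have "(u, h) \<in> space (seed A \<Otimes>\<^sub>M (\<Pi>\<^sub>M i\<in>{..<n}. example_space))"
        using u by (simp add: space_pair_measure)
      from measurable_compose[OF measurable_Pair1'[OF this] L]
      show "risk lam (law V) (learned A u h)
        - risk lam (law V) (bayes_classifier lam (reg V)) = excess V (learned A u h)"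
        by (intro risk_diff_law) simp
    qed
    then show "?E V u (\<lambda>h. risk lam (law V) (learned A u h) - risk lam (law V) (bayes_classifier lam (reg V)))
      = ?E V u (\<lambda>h. excess V (learned A u h))"
      by (intro integral_cong_AE) auto
  qed
  have int: "integrable (seed A) (f V)" for V
  proof (rule integrable_const_bound[where B = 1])
    have "0 \<le> f V u \<and> f V u \<le> 1" for u
    proof
      show "0 \<le> f V u" unfolding f_def by (intro Bochner_Integration.integral_nonneg excess_bounds)
      have "f V u \<le> ?E V u (\<lambda>_. 1)"
        unfolding f_def by (intro integral_mono IT excess_bounds)
      then show "f V u \<le> 1" by simp
    qed
    then show "AE u in seed A. norm (f V u) \<le> 1" by simp
    show "f V \<in> borel_measurable (seed A)"
      unfolding f_def using measurable_excess_learned[OF A]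
      by (intro measurable_expectation_transcript[OF A reg_measurable reg_bounds order_refl])
  qed
  let ?q = "height powr (1 + \<alpha>0) / 6"
  have f_ge: "2 ^ card K * ?q \<le> (\<Sum>V\<in>Pow K. f V u)" for u
  proof -
    have m: "card K > 0" using finite_K K_nonempty by (simp add: card_gt_0_iff)
    let ?w = "height powr \<alpha>0 * height / card K"
    let ?e = "\<lambda>V z. measure_pmf.prob (transcript A (reg V) u n) {h. (learned A u h z = None) \<noteq> (z \<in> V)}"
    have "2 ^ card K * ?q = ?w * (2 ^ card K * (card K / 6))"
      using m height by (simp add: powr_add)
    also have "\<dots> \<le> ?w * (\<Sum>V\<in>Pow K. \<Sum>z\<in>K. ?e V z)"
      using sum_errors_ge[OF budget] height by (intro mult_left_mono) auto
    also have "\<dots> = (\<Sum>V\<in>Pow K. ?w * (\<Sum>z\<in>K. ?e V z))"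
      by (rule sum_distrib_left)
    also have "\<dots> \<le> (\<Sum>V\<in>Pow K. f V u)"
    proof (rule sum_mono)
      fix V
      have "?w * (\<Sum>z\<in>K. ?e V z)
        = ?E V u (\<lambda>h. ?w * (\<Sum>z\<in>K. indicator {h. (learned A u h z = None) \<noteq> (z \<in> V)} h))"
        by (simp add: IT)
      also have "\<dots> = ?E V u (\<lambda>h. ?w * (\<Sum>z\<in>K. of_bool ((learned A u h z = None) \<noteq> (z \<in> V))))"
        by (simp add: indicator_def of_bool_def)
      also have "\<dots> \<le> f V u"
        unfolding f_def by (intro integral_mono IT excess_ge)
      finally show "?w * (\<Sum>z\<in>K. ?e V z) \<le> f V u" .
    qed
    finally show ?thesis .
  qed
  have "2 ^ card K * ?q = (\<integral>u. 2 ^ card K * ?q \<partial>seed A)" by (simp add: prob_space)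
  also have "\<dots> \<le> (\<integral>u. (\<Sum>V\<in>Pow K. f V u) \<partial>seed A)"
    by (intro integral_mono f_ge Bochner_Integration.integrable_sum int) auto
  also have "\<dots> = (\<Sum>V\<in>Pow K. \<integral>u. f V u \<partial>seed A)"
    by (intro Bochner_Integration.integral_sum int)
  finally have "(\<Sum>V\<in>Pow K. ?q) \<le> (\<Sum>V\<in>Pow K. \<integral>u. f V u \<partial>seed A)"
    using finite_K by (simp add: card_Pow)
  moreover have "(\<Sum>V\<in>Pow K. \<integral>u. f V u \<partial>seed A) < (\<Sum>V\<in>Pow K. ?q)"
    if "\<And>V. (\<integral>u. f V u \<partial>seed A) < ?q"
    using that finite_K by (intro sum_strict_mono) auto
  ultimately show ?thesis unfolding excess_eq by (meson not_le)
qed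

end

section \<open>The lower bound\<close>

text \<open>All coordinates are multiples of \<open>1 / (2 * M)\<close> below \<open>1/2\<close>;
  distinct points differ by a full step in some coordinate.\<close>

lemma exists_grid:
  assumes "1 \<le> M"
  shows "\<exists>K :: (real ^ 'n::finite) set. finite K \<and> card K = M ^ CARD('n) \<and> K \<subseteq> cbox 0 1 \<and>
    (\<forall>z\<in>K. \<forall>i. z $ i \<le> 1/2) \<and> (\<forall>z\<in>K. \<forall>w\<in>K. z \<noteq> w \<longrightarrow> 1 / (2 * real M) \<le> norm (z - w))"
proof -
  define pt :: "('n \<Rightarrow> nat) \<Rightarrow> real ^ 'n" where "pt f = (\<chi> i. real (f i) / (2 * real M))" for f
  define K where "K = pt ` (UNIV \<rightarrow>\<^sub>E {..<M})"
  have M: "0 < real M" using assms by simp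
  have "inj pt"
    using M by (auto simp: inj_def pt_def vec_eq_iff fun_eq_iff)
  then have "card K = M ^ CARD('n)"
    unfolding K_def by (subst card_image) (auto simp: card_PiE inj_on_subset intro: inj_on_subset)
  moreover have "finite K" unfolding K_def by (intro finite_imageI finite_PiE) auto
  moreover have half: "0 \<le> z $ i \<and> z $ i \<le> 1/2" if z: "z \<in> K" for z i
  proof -
    obtain f where f: "z = pt f" "f i < M" using z by (auto simp: K_def)
    then show ?thesis using M by (simp add: pt_def field_simps)
  qed
  moreover have "K \<subseteq> cbox 0 1"
  proof
    fix z assume "z \<in> K"
    then have "0 \<le> z $ i" "z $ i \<le> 1" for i using half[of z i] by auto
    then show "z \<in> cbox 0 1" by (simp add: mem_box_cart)
  qed
  moreover have "1 / (2 * real M) \<le> norm (z - w)" if zw: "z \<in> K" "w \<in> K" "z \<noteq> w" for z w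
  proof -
    obtain f g where fg: "z = pt f" "w = pt g" using zw by (auto simp: K_def)
    with \<open>z \<noteq> w\<close> obtain i where "f i \<noteq> g i" by (metis ext)
    then have "1 \<le> \<bar>real (f i) - real (g i)\<bar>" by linarith
    then have "1 / (2 * real M) \<le> \<bar>real (f i) - real (g i)\<bar> / (2 * real M)"
      using M by (intro divide_right_mono) auto
    also have "\<dots> = \<bar>(z - w) $ i\<bar>" using M by (simp add: fg pt_def flip: diff_divide_distrib)
    also have "\<dots> \<le> norm (z - w)" by (rule component_le_norm_cart)
    finally show ?thesis .
  qed
  ultimately show ?thesis by blast
qed

text \<open>The hard instances share one margin constant for all \<open>n\<close>, which gives the
  second conjunct. The first follows because the supremum over a larger class is larger.\<close>

theorem theorem2:
  fixes lam \<alpha>0 \<beta> L :: real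
  assumes "0 < lam" and "lam < 1 / 2"
    and "0 < \<alpha>0"
    and "0 < \<beta>" and "\<beta> \<le> 1"
    and "3 \<le> L"
  shows "(\<exists>C>0. \<forall>n\<ge>1.
            (INF A\<in>(learners n :: ('n::finite) learner set).
               SUP (P, \<eta>)\<in>instances L \<beta> \<alpha>0 lam. ereal (expected_excess_risk lam n A P \<eta>))
            \<ge> ereal (C * real n powr (- (\<beta> * (1 + \<alpha>0) / (2 * \<beta> + real CARD('n))))))
       \<and> (\<exists>C0>0. \<exists>C>0. \<forall>n\<ge>1.
            (INF A\<in>(learners n :: 'n learner set).
               SUP (P, \<eta>)\<in>instances_with C0 L \<beta> \<alpha>0 lam. ereal (expected_excess_risk lam n A P \<eta>))
            \<ge> ereal (C * real n powr (- (\<beta> * (1 + \<alpha>0) / (2 * \<beta> + real CARD('n))))))"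
proof -
  define D where "D = 2 * \<beta> + real CARD('n)"
  define c where "c = min lam (1 / 2 - lam) / 4"
  define C0 where "C0 = ((1 / 2 - lam) / 2) powr - \<alpha>0"
  \<comment> \<open>The factor \<open>8 powr - \<beta>\<close> comes from
    \<open>r \<ge> 1 / (8 * n powr (1 / D))\<close>, the divisor \<open>6\<close> from
    \<open>exists_hard_instance\<close>.\<close>
  define C where "C = (c * 8 powr - \<beta>) powr (1 + \<alpha>0) / 6"
  have D: "0 < D" using assms by (simp add: D_def add_pos_pos)
  have c: "0 < c" "c \<le> lam / 4" "c \<le> (1 / 2 - lam) / 4" using assms by (auto simp: c_def)
  have C: "0 < C" and C0: "0 < C0" using c assms by (auto simp: C_def C0_def)
  have main: "\<exists>(P, \<eta>) \<in> instances_with C0 L \<beta> \<alpha>0 lam.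
      C * real n powr (- (\<beta> * (1 + \<alpha>0) / D)) \<le> expected_excess_risk lam n A P \<eta>"
    if n: "1 \<le> n" and A: "A \<in> learners n" for n and A :: "'n learner"
  proof -
    \<comment> \<open>This choice gives \<open>n \<le> M powr D\<close>, which balances the queries
      per bump against the information per query.\<close>
    define M where "M = nat \<lceil>real n powr (1 / D)\<rceil>"
    have "1 \<le> real n powr (1 / D)" using n D by (intro ge_one_powr_ge_zero) auto
    then have M: "1 \<le> M" "real n powr (1 / D) \<le> real M" "real M \<le> 2 * real n powr (1 / D)"
      unfolding M_def by linarith+
    \<comment> \<open>Half the grid spacing, so the balls are disjoint.\<close>
    define r where "r = 1 / (4 * real M)"
    obtain K :: "'n point set" where K: "finite K" "card K = M ^ CARD('n)" "K \<subseteq> cbox 0 1"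
      "\<And>z i. z \<in> K \<Longrightarrow> z $ i \<le> 1/2"
      "\<And>z w. z \<in> K \<Longrightarrow> w \<in> K \<Longrightarrow> z \<noteq> w \<Longrightarrow> 1 / (2 * real M) \<le> norm (z - w)"
      using exists_grid[OF M(1), where 'n = 'n] by blast
    have "0 < card K" using K(2) M(1) by simp
    then have "K \<noteq> {}" by auto
    \<comment> \<open>Any coordinate can carry the slope, since every coordinate of every grid point
      is at most \<open>1/2\<close>; hence \<open>undefined\<close>.\<close>
    interpret hard_instances K \<beta> r undefined lam \<alpha>0 c
      by unfold_locales (use K \<open>K \<noteq> {}\<close> assms c M(1) in \<open>auto simp: r_def\<close>)
    have "real n = (real n powr (1 / D)) powr D" using n D by (simp add: powr_powr)
    also have "\<dots> \<le> real M powr D" using M D by (intro powr_mono2) auto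
    also have "\<dots> = real M powr (2 * \<beta>) * card K"
      using M(1) by (simp add: D_def powr_add K(2) powr_realpow)
    finally have n_le: "real n \<le> real M powr (2 * \<beta>) * card K" .
    have "height = c / (4 powr \<beta> * real M powr \<beta>)"
      unfolding height_def unfolding r_def using M(1) by (simp add: powr_divide powr_mult)
    moreover have "real M powr (2 * \<beta>) = (real M powr \<beta>)\<^sup>2"
      by (simp add: power2_eq_square flip: powr_add)
    \<comment> \<open>The powers of \<open>M\<close> cancel, so the information budget is controlled
      by \<open>c\<close> alone, uniformly in \<open>n\<close>.\<close>
    ultimately have "height\<^sup>2 * real M powr (2 * \<beta>) = (c / 4 powr \<beta>)\<^sup>2"
      using M(1) by (simp add: power_divide power_mult_distrib)
    also have "\<dots> \<le> (lam / 4)\<^sup>2"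
    proof (intro power_mono)
      have "c / 4 powr \<beta> \<le> c / 1" using c assms by (intro divide_left_mono) (auto intro: ge_one_powr_ge_zero)
      also have "\<dots> \<le> lam / 4" using c by simp
      finally show "c / 4 powr \<beta> \<le> lam / 4" .
    qed (use c in auto)
    also have "\<dots> \<le> lam / 8" using assms by (simp add: power2_eq_square)
    finally have h: "height\<^sup>2 * real M powr (2 * \<beta>) \<le> lam / 8" .
    have "2 * height\<^sup>2 / lam * real n \<le> 2 * height\<^sup>2 / lam * (real M powr (2 * \<beta>) * card K)"
      using n_le assms by (intro mult_left_mono) auto
    also have "\<dots> = 2 / lam * (height\<^sup>2 * real M powr (2 * \<beta>)) * card K" by simp
    also have "\<dots> \<le> 2 / lam * (lam / 8) * card K"
      using h assms by (intro mult_right_mono mult_left_mono) auto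
    also have "\<dots> = card K / 4" using assms by simp
    finally obtain V where V: "height powr (1 + \<alpha>0) / 6 \<le> expected_excess_risk lam n A (law V) (reg V)"
      using exists_hard_instance[OF A] by blast
    \<comment> \<open>Rounding up at most doubles \<open>n powr (1 / D)\<close>, so
      \<open>4 * M\<close> is at most \<open>8\<close> times it.\<close>
    have "1 / (8 * real n powr (1 / D)) \<le> r"
      unfolding r_def using M n by (intro divide_left_mono mult_pos_pos) auto
    then have "(1 / (8 * real n powr (1 / D))) powr \<beta> \<le> r powr \<beta>"
      using assms by (intro powr_mono2) auto
    then have "c * (8 powr - \<beta> * real n powr (- (\<beta> / D))) \<le> height"
      unfolding height_def using c n
      by (intro mult_left_mono) (auto simp: powr_divide powr_mult powr_powr powr_minus_divide)
    then have "(c * 8 powr - \<beta> * real n powr (- (\<beta> / D))) powr (1 + \<alpha>0) \<le> height powr (1 + \<alpha>0)"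
      using c assms by (intro powr_mono2) (auto simp: mult.assoc)
    moreover have "(c * 8 powr - \<beta> * real n powr (- (\<beta> / D))) powr (1 + \<alpha>0)
      = 6 * (C * real n powr (- (\<beta> * (1 + \<alpha>0) / D)))"
      using c by (simp add: C_def powr_mult powr_powr)
    ultimately have "C * real n powr (- (\<beta> * (1 + \<alpha>0) / D)) \<le> expected_excess_risk lam n A (law V) (reg V)"
      using V by linarith
    then show ?thesis using law_in_instances[OF \<open>3 \<le> L\<close>, of V] unfolding C0_def by blast
  qed
  \<comment> \<open>Stated for any class containing the hard instances, to cover both conjuncts at
    once.\<close>
  have bound: "ereal (C * real n powr (- (\<beta> * (1 + \<alpha>0) / D))) \<le>
      (INF A\<in>(learners n :: 'n learner set). SUP (P, \<eta>)\<in>\<I>. ereal (expected_excess_risk lam n A P \<eta>))"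
    if "1 \<le> n" and sub: "instances_with C0 L \<beta> \<alpha>0 lam \<subseteq> \<I>" for n \<I>
  proof (rule INF_greatest)
    fix A :: "'n learner" assume "A \<in> learners n"
    from main[OF \<open>1 \<le> n\<close> this] obtain P \<eta> where "(P, \<eta>) \<in> \<I>"
      "C * real n powr (- (\<beta> * (1 + \<alpha>0) / D)) \<le> expected_excess_risk lam n A P \<eta>"
      using sub by blast
    then show "ereal (C * real n powr (- (\<beta> * (1 + \<alpha>0) / D))) \<le>
        (SUP (P, \<eta>)\<in>\<I>. ereal (expected_excess_risk lam n A P \<eta>))"
      by (intro SUP_upper2[of "(P, \<eta>)"]) auto
  qed
  have "instances_with C0 L \<beta> \<alpha>0 lam \<subseteq> instances L \<beta> \<alpha>0 lam"
    using C0 by (auto simp: instances_def)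
  then show ?thesis using bound C C0 unfolding D_def by blast
qed

end
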